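(* Let $d\ge 2$ and $n\ge 1$ be integers and let $\mathcal{H}$ be a $d$-uniform hypergraph on the vertex set $\{x_{ji}\mid 1\le j\le n,\ 1\le i\le d\}$ (with $nd$ distinct vertices) such that $$\{\{x_{j1},x_{j2},\ldots,x_{jd}\}\mid 1\le j\le n\}$$ is a perfect matching of $\mathcal{H}$. Suppose that for every $1\le q\le n$ the following holds: if $\mathfrak{e}_1,\mathfrak{e}_2$ are (possibly equal) submaximal edges such that $\mathfrak{e}_1\sim x_{qi_1}$ and $\mathfrak{e}_2\sim x_{qi_2}$, where $i_1,i_2\in\{1,\ldots,d\}$ are distinct, then $\mathfrak{e}_1\cup\mathfrak{e}_2$ is not independent. Then $\mathcal{H}$ is unmixed.
   Context: A hypergraph $\mathcal{H}$ on a finite nonempty set $V=V(\mathcal{H})$ (the vertices) is a set $E(\mathcal{H})$ of nonempty subsets of $V$ (the hyperedges) whose union is $V$. It is $d$-uniform if every hyperedge has exactly $d$ elements. A matching is a set of pairwise disjoint hyperedges; it is perfect if every vertex lies in one of its elements. A subset of $V(\mathcal{H})$ is independent if it does not contain any hyperedge as a subset. A vertex cover is a subset of $V(\mathcal{H})$ that intersects every hyperedge; it is minimal if no proper subset of it is a vertex cover. $\mathcal{H}$ is unmixed if all its minimal vertex covers have the same cardinality. In a $d$-uniform hypergraph, a submaximal edge is a $(d-1)$-element subset of a hyperedge. For a submaximal edge $\mathfrak{e}$ and a vertex $v$, write $\mathfrak{e}\sim v$ if $\mathfrak{e}\cup\{v\}\in E(\mathcal{H})$. *)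

theory Defs
  imports Main
begin

text \<open>A hypergraph is given by its vertex set \<open>V\<close> and its set of hyperedges \<open>E\<close>.\<close>

definition hypergraph :: "'a set \<Rightarrow> 'a set set \<Rightarrow> bool" where
  "hypergraph V E \<longleftrightarrow>
     finite V \<and> V \<noteq> {} \<and> (\<forall>e\<in>E. e \<noteq> {} \<and> e \<subseteq> V) \<and> \<Union>E = V"

definition uniform_hypergraph :: "nat \<Rightarrow> 'a set \<Rightarrow> 'a set set \<Rightarrow> bool" where
  "uniform_hypergraph d V E \<longleftrightarrow> hypergraph V E \<and> (\<forall>e\<in>E. card e = d)"

definition matching :: "'a set set \<Rightarrow> 'a set set \<Rightarrow> bool" where
  "matching E M \<longleftrightarrow> M \<subseteq> E \<and> pairwise disjnt M"

definition perfect_matching :: "'a set \<Rightarrow> 'a set set \<Rightarrow> 'a set set \<Rightarrow> bool" where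
  "perfect_matching V E M \<longleftrightarrow> matching E M \<and> (\<forall>v\<in>V. \<exists>e\<in>M. v \<in> e)"

definition independent_set :: "'a set \<Rightarrow> 'a set set \<Rightarrow> 'a set \<Rightarrow> bool" where
  "independent_set V E A \<longleftrightarrow> A \<subseteq> V \<and> \<not> (\<exists>e\<in>E. e \<subseteq> A)"

definition vertex_cover :: "'a set \<Rightarrow> 'a set set \<Rightarrow> 'a set \<Rightarrow> bool" where
  "vertex_cover V E C \<longleftrightarrow> C \<subseteq> V \<and> (\<forall>e\<in>E. C \<inter> e \<noteq> {})"

definition minimal_vertex_cover :: "'a set \<Rightarrow> 'a set set \<Rightarrow> 'a set \<Rightarrow> bool" where
  "minimal_vertex_cover V E C \<longleftrightarrow>
     vertex_cover V E C \<and> (\<forall>D. D \<subset> C \<longrightarrow> \<not> vertex_cover V E D)"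

definition unmixed :: "'a set \<Rightarrow> 'a set set \<Rightarrow> bool" where
  "unmixed V E \<longleftrightarrow>
     (\<forall>C D. minimal_vertex_cover V E C \<and> minimal_vertex_cover V E D \<longrightarrow> card C = card D)"

text \<open>
  In the next two definitions \<open>E\<close> is meant to be the set of hyperedges of a \<open>d\<close>-uniform
  hypergraph with \<open>d \<ge> 1\<close>, so that the truncated subtraction \<open>d - 1\<close> is harmless and every
  hyperedge is finite.
\<close>

definition submaximal_edge :: "nat \<Rightarrow> 'a set set \<Rightarrow> 'a set \<Rightarrow> bool" where
  "submaximal_edge d E s \<longleftrightarrow> card s = d - 1 \<and> (\<exists>e\<in>E. s \<subseteq> e)"

definition edge_adj :: "'a set set \<Rightarrow> 'a set \<Rightarrow> 'a \<Rightarrow> bool" where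
  "edge_adj E s v \<longleftrightarrow> s \<union> {v} \<in> E"

end

theory Submission
  imports Defs
begin

text \<open>
  A minimal vertex cover \<open>C\<close> meets each edge of the perfect matching in exactly one vertex, so
  \<open>card C = n\<close>. Indeed, if \<open>u\<close> and \<open>v\<close> were two vertices of \<open>C\<close> in the same matching edge, minimality
  would provide hyperedges \<open>f\<close> and \<open>g\<close> with \<open>f \<inter> C = {u}\<close> and \<open>g \<inter> C = {v}\<close>; then
  \<open>(f - {u}) \<union> (g - {v})\<close> avoids \<open>C\<close> and hence is independent, contrary to the hypothesis.
\<close>

text \<open>By minimality, deleting \<open>v\<close> leaves some hyperedge uncovered; as
  \<open>C\<close> itself covers that hyperedge, \<open>v\<close> must be the only point where they
  meet.\<close>

lemma minimal_vertex_cover_private_edge: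
  assumes "minimal_vertex_cover V E C" and "v \<in> C"
  obtains e where "e \<in> E" and "C \<inter> e = {v}"
proof -
  have cover: "vertex_cover V E C"
    using assms(1) by (simp add: minimal_vertex_cover_def)
  have "C - {v} \<subset> C"
    using assms(2) by blast
  then have "\<not> vertex_cover V E (C - {v})"
    using assms(1) by (simp add: minimal_vertex_cover_def)
  then obtain e where "e \<in> E" and "(C - {v}) \<inter> e = {}"
    using cover by (auto simp: vertex_cover_def)
  moreover have "C \<inter> e \<noteq> {}"
    using cover \<open>e \<in> E\<close> by (simp add: vertex_cover_def)
  ultimately show thesis
    using that by blast
qed

lemma independent_set_avoiding_cover:
  assumes "vertex_cover V E C" and "A \<subseteq> V" and "C \<inter> A = {}"
  shows "independent_set V E A"
  using assms unfolding vertex_cover_def independent_set_def by blast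

text \<open>Puts a hyperedge through \<open>v\<close> into the form in which the hypothesis of the
  theorem speaks of submaximal edges.\<close>

lemma uniform_hypergraph_remove_vertex:
  assumes "uniform_hypergraph d V E" and "e \<in> E" and "v \<in> e"
  shows "submaximal_edge d E (e - {v})" and "edge_adj E (e - {v}) v"
proof -
  show "submaximal_edge d E (e - {v})"
    using assms by (auto simp: submaximal_edge_def uniform_hypergraph_def)
  show "edge_adj E (e - {v}) v"
    using assms(2,3) by (simp add: edge_adj_def insert_absorb)
qed

text \<open>The edges of \<open>M\<close> are disjoint and cover \<open>V\<close>, so their traces
  on \<open>C\<close> partition \<open>C\<close>, and each trace contributes one vertex.\<close>

lemma card_eq_card_perfect_matching:
  assumes "finite V" and "perfect_matching V E M" and "C \<subseteq> V"
    and single: "\<And>e. e \<in> M \<Longrightarrow> card (C \<inter> e) = 1"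
  shows "card C = card M"
proof -
  have disj: "pairwise disjnt M" and "V \<subseteq> \<Union>M"
    using assms(2) by (auto simp: perfect_matching_def matching_def)
  have "C = (\<Union>e\<in>M. C \<inter> e)"
    using \<open>V \<subseteq> \<Union>M\<close> \<open>C \<subseteq> V\<close> by blast
  \<comment> \<open>This yields finiteness of \<open>M\<close>: the traces are subsets of the finite
    set \<open>C\<close>, and disjoint edges with nonempty traces cannot share a trace.\<close>
  have inj: "inj_on ((\<inter>) C) M"
  proof (rule inj_onI)
    fix e f assume ef: "e \<in> M" "f \<in> M" "C \<inter> e = C \<inter> f"
    have "C \<inter> e \<noteq> {}"
      using single[OF ef(1)] by auto
    then have "\<not> disjnt e f"
      using ef(3) by (auto simp: disjnt_def)
    then show "e = f"
      using disj ef by (auto simp: pairwise_def)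
  qed
  have "finite C"
    using assms(1,3) finite_subset by blast
  then have "finite ((\<inter>) C ` M)"
    by (auto intro: finite_subset[of _ "Pow C"])
  then have "finite M"
    using inj by (rule finite_imageD)
  have "card (\<Union>e\<in>M. C \<inter> e) = (\<Sum>e\<in>M. card (C \<inter> e))"
    using \<open>finite M\<close> \<open>finite C\<close> disj
    by (intro card_UN_disjoint) (auto simp: pairwise_def disjnt_def)
  also have "\<dots> = card M"
    using single by simp
  finally show ?thesis
    using \<open>C = (\<Union>e\<in>M. C \<inter> e)\<close> by simp
qed

theorem proposition3p8:
  fixes d n :: nat
    and x :: "nat \<Rightarrow> nat \<Rightarrow> 'a"
    and V :: "'a set"
    and E :: "'a set set"
  assumes "d \<ge> 2"
    and "n \<ge> 1"
    and "inj_on (\<lambda>(j, i). x j i) ({1..n} \<times> {1..d})"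
    and "V = {x j i | j i. j \<in> {1..n} \<and> i \<in> {1..d}}"
    and "uniform_hypergraph d V E"
    and "perfect_matching V E {{x j i | i. i \<in> {1..d}} | j. j \<in> {1..n}}"
    and "\<And>q e1 e2 i1 i2. \<lbrakk>q \<in> {1..n}; i1 \<in> {1..d}; i2 \<in> {1..d}; i1 \<noteq> i2;
           submaximal_edge d E e1; submaximal_edge d E e2;
           edge_adj E e1 (x q i1); edge_adj E e2 (x q i2)\<rbrakk>
         \<Longrightarrow> \<not> independent_set V E (e1 \<union> e2)"
  shows "unmixed V E"
proof -
  define M where "M = {{x j i | i. i \<in> {1..d}} | j. j \<in> {1..n}}"
  have pm: "perfect_matching V E M"
    using assms(6) by (simp add: M_def)
  have "finite V" and edge_sub: "\<And>e. e \<in> E \<Longrightarrow> e \<subseteq> V"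
    using assms(5) by (auto simp: uniform_hypergraph_def hypergraph_def)
  \<comment> \<open>Comparing every minimal cover with the fixed number \<open>card M\<close> makes
    any two of them equal in size.\<close>
  have "card C = card M" if min: "minimal_vertex_cover V E C" for C
  proof (rule card_eq_card_perfect_matching[OF \<open>finite V\<close> pm])
    have cover: "vertex_cover V E C"
      using min by (simp add: minimal_vertex_cover_def)
    then show "C \<subseteq> V"
      by (simp add: vertex_cover_def)
    fix m assume "m \<in> M"
    then obtain q where q: "q \<in> {1..n}" and m: "m = {x q i | i. i \<in> {1..d}}"
      by (auto simp: M_def)
    \<comment> \<open>A matching edge is itself a hyperedge, so the cover meets it at least once;
      uniqueness of the meeting point follows by contradiction.\<close>
    have "m \<in> E"
      using pm \<open>m \<in> M\<close> by (auto simp: perfect_matching_def matching_def)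
    then obtain u where u: "u \<in> C \<inter> m"
      using cover by (auto simp: vertex_cover_def)
    have "v = u" if v: "v \<in> C \<inter> m" for v
    proof (rule ccontr)
      assume "v \<noteq> u"
      \<comment> \<open>Both vertices lie in the matching edge with index \<open>q\<close>, so the
        hypothesis for this single \<open>q\<close> applies to them.\<close>
      obtain i1 i2 where i: "i1 \<in> {1..d}" "u = x q i1" "i2 \<in> {1..d}" "v = x q i2"
        using u v m by blast
      obtain f where f: "f \<in> E" "C \<inter> f = {u}"
        using minimal_vertex_cover_private_edge[OF min] u by blast
      obtain g where g: "g \<in> E" "C \<inter> g = {v}"
        using minimal_vertex_cover_private_edge[OF min] v by blast
      have "independent_set V E ((f - {u}) \<union> (g - {v}))"
        by (rule independent_set_avoiding_cover[OF cover])
          (use f g edge_sub in blast)+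
      moreover have "\<not> independent_set V E ((f - {u}) \<union> (g - {v}))"
      proof (rule assms(7)[OF q i(1) i(3)])
        show "i1 \<noteq> i2"
          using i \<open>v \<noteq> u\<close> by auto
        have "u \<in> f" "v \<in> g"
          using f g by auto
        then show "submaximal_edge d E (f - {u})" "edge_adj E (f - {u}) (x q i1)"
          "submaximal_edge d E (g - {v})" "edge_adj E (g - {v}) (x q i2)"
          using uniform_hypergraph_remove_vertex[OF assms(5)] f g i by auto
      qed
      ultimately show False
        by blast
    qed
    then have "C \<inter> m = {u}"
      using u by blast
    then show "card (C \<inter> m) = 1"
      by simp
  qed
  then show ?thesis
    by (simp add: unmixed_def)
qed

end
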